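(* Let $J$ be a positive odd integer and let $n\ge 0$ be an integer. Then $$\sum_{j=0}^{n+1}\left(\frac{-1}{2J}\right)^{j}\frac{\mathcal{E}(1+n+j)}{\Gamma(n-j+2)\,\Gamma(j+1)}=\frac{2\,(-1)^{(J+1)/2}}{(2J)^{n+1}\,\Gamma(n+2)}\sum_{k=1}^{(J-1)/2}(-1)^{k}\left(J^{2}-4k^{2}\right)^{n+1}-2^{n+2}\sum_{j=0}^{n+1}\left(-\frac1J\right)^{j}\frac{1}{\Gamma(n-j+2)\,\Gamma(j+1)}\sum_{k=1}^{J}(-1)^{k}\left(k-\tfrac12\right)^{1+n+j}+\frac{(-1)^{(J+1)/2}\,(J/2)^{n+1}}{\Gamma(n+2)} ,$$ where an empty sum equals $0$.
   Context: $\mathcal{E}(n)$ denotes the $n$-th Euler number, defined by $\frac{1}{\cosh t}=\sum_{n\ge0}\mathcal{E}(n)\frac{t^n}{n!}$. *)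

theory Defs
  imports "HOL-Analysis.Analysis"
begin

definition fps_cosh :: "real fps" where
  "fps_cosh = fps_const (1/2) * (fps_exp 1 + fps_exp (-1))"

definition euler_number :: "nat \<Rightarrow> real" where
  "euler_number n = fact n * fps_nth (inverse fps_cosh) n"

text \<open>
  The formal definition agrees with the analytic generating function: the power series with
  coefficients \<open>euler_number n / fact n\<close> has positive radius of convergence and sums to
  \<open>1 / cosh t\<close> near \<open>0\<close>.
\<close>

lemma euler_number_has_fps_expansion:
  "(\<lambda>t::real. 1 / cosh t) has_fps_expansion Abs_fps (\<lambda>n. euler_number n / fact n)"
proof -
  have "(\<lambda>t::real. 1/2 * (exp (1 * t) + exp (-1 * t))) has_fps_expansion fps_cosh"
    unfolding fps_cosh_def by (intro fps_expansion_intros)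
  moreover have "(\<lambda>t::real. 1/2 * (exp (1 * t) + exp (-1 * t))) = cosh"
    by (auto simp: cosh_def)
  ultimately have cosh: "(cosh :: real \<Rightarrow> real) has_fps_expansion fps_cosh"
    by simp
  have "fps_nth fps_cosh 0 \<noteq> 0"
    by (simp add: fps_cosh_def)
  from has_fps_expansion_inverse[OF cosh this]
  have "(\<lambda>t::real. 1 / cosh t) has_fps_expansion inverse fps_cosh"
    by (simp add: divide_inverse)
  moreover have "Abs_fps (\<lambda>n. euler_number n / fact n) = inverse fps_cosh"
    by (simp add: fps_eq_iff euler_number_def)
  ultimately show ?thesis
    by simp
qed

end

theory Submission
  imports Defs
begin

text \<open>
  Let \<open>L\<close> be the linear functional on polynomials that sends \<open>x\<^sup>i\<close> to the \<open>i\<close>-th Euler number,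
  so that \<open>L(e\<^sup>x\<^sup>t) = 1 / cosh t\<close> formally. Multiplying by \<open>e\<^sup>t + e\<^sup>-\<^sup>t\<close> turns the generating function
  into the rule \<open>L(p(x + 1)) + L(p(x - 1)) = 2 p(0)\<close> (lemma \<open>umbral_shift\<close>), and its evenness into
  \<open>L(p(-x)) = L(p(x))\<close> (lemma \<open>umbral_reflect\<close>).

  Put \<open>N = n + 1\<close> and \<open>p(x) = (x (1 - x / (2J)))\<^sup>N\<close>. Expanding the binomial shows that the left-hand
  side of the theorem is \<open>L(p) / N!\<close>. Since \<open>p(2J - x) = p(x)\<close>, shifting \<open>p\<close> by \<open>2J\<close> is the same as
  reflecting it, and therefore does not change \<open>L\<close>. On the other hand \<open>J\<close> applications of the shift
  rule, an odd number, relate \<open>L(p(x + 2J))\<close> to \<open>-L(p)\<close>. Comparing the two gives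
  \<open>L(p) = p(1) - p(3) + p(5) - \<dots> + p(2J - 1)\<close> (lemma \<open>umbral_symmetric\<close>).

  The right-hand side of the theorem contains this alternating sum twice. Its double sum is
  the binomial expansion of each \<open>p(2k - 1)\<close>, and contributes \<open>2 L(p) / N!\<close>. The other two terms are
  the same alternating sum folded about its centre \<open>J\<close> (lemma \<open>alternating_sum_fold\<close>), where
  \<open>p(J + 2k) = ((J\<^sup>2 - 4k\<^sup>2) / (2J))\<^sup>N\<close>, and contribute \<open>-L(p) / N!\<close>.
\<close>

section \<open>The recurrence of the Euler numbers\<close>

lemma fps_nth_fps_cosh: "fps_nth fps_cosh k = (1 + (-1) ^ k) / (2 * fact k)"
  by (simp add: fps_cosh_def field_simps)

text \<open>The coefficients of \<open>(1 / cosh t) * (2 cosh t) = 2\<close>, scaled by \<open>m!\<close>.\<close>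

lemma euler_number_recurrence:
  "(\<Sum>i\<le>m. real (m choose i) * euler_number i * (1 + (-1) ^ (m - i))) = (if m = 0 then 2 else 0)"
proof -
  have "inverse fps_cosh * fps_cosh = 1"
    by (rule inverse_mult_eq_1) (simp add: fps_cosh_def)
  then have "(\<Sum>i=0..m. fps_nth (inverse fps_cosh) i * fps_nth fps_cosh (m - i)) = (if m = 0 then 1 else 0)"
    by (metis fps_mult_nth fps_one_nth)
  moreover have "real (m choose i) * euler_number i * (1 + (-1) ^ (m - i))
      = 2 * fact m * (fps_nth (inverse fps_cosh) i * fps_nth fps_cosh (m - i))" if "i \<le> m" for i
    using that by (simp add: euler_number_def fps_nth_fps_cosh binomial_fact)
  ultimately show ?thesis
    by (simp add: sum_distrib_left[symmetric] atLeast0AtMost)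
qed

lemma euler_number_odd: "odd m \<Longrightarrow> euler_number m = 0"
proof (induction m rule: less_induct)
  case (less m)
  have "real (m choose i) * euler_number i * (1 + (-1) ^ (m - i)) = 0" if "i < m" for i
    using less that by (cases "even i") auto
  then have "(\<Sum>i<m. real (m choose i) * euler_number i * (1 + (-1) ^ (m - i))) = 0"
    by (intro sum.neutral) blast
  with euler_number_recurrence[of m] less.prems show ?case
    by (auto simp: lessThan_Suc_atMost[symmetric] split: if_splits)
qed

section \<open>The umbral functional\<close>

definition umbral :: "real poly \<Rightarrow> real" where
  "umbral p = (\<Sum>i\<le>degree p. coeff p i * euler_number i)"

lemma umbral_eq_sum:
  assumes "degree p \<le> d"
  shows "umbral p = (\<Sum>i\<le>d. coeff p i * euler_number i)"
  unfolding umbral_def using assms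
  by (intro sum.mono_neutral_left) (auto simp: coeff_eq_0)

lemma umbral_0 [simp]: "umbral 0 = 0"
  by (simp add: umbral_def)

lemma umbral_add: "umbral (p + q) = umbral p + umbral q"
proof -
  let ?d = "max (degree p) (degree q)"
  show ?thesis
    by (simp add: umbral_eq_sum[of p ?d] umbral_eq_sum[of q ?d] umbral_eq_sum[of "p + q" ?d]
        degree_add_le distrib_right sum.distrib)
qed

lemma umbral_smult: "umbral (smult c p) = c * umbral p"
  by (simp add: umbral_eq_sum[of "smult c p" "degree p"] umbral_eq_sum[of p "degree p"]
      degree_smult_le sum_distrib_left mult.assoc)

lemma umbral_sum: "umbral (\<Sum>i\<in>A. f i) = (\<Sum>i\<in>A. umbral (f i))"
  by (induction A rule: infinite_finite_induct) (auto simp: umbral_add)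

lemma umbral_monom [simp]: "umbral (monom c m) = c * euler_number m"
  by (subst umbral_eq_sum[of _ m]) (auto simp: degree_monom_le coeff_monom if_distrib if_distribR sum.delta cong: if_cong)

text \<open>
  The functional is not multiplicative, but linearity still reduces the effect of a substitution
  to the powers of the substituted polynomial.
\<close>

lemma umbral_pcompose:
  "umbral (pcompose p q) = (\<Sum>m\<le>degree p. coeff p m * umbral (q ^ m))"
  by (simp add: pcompose_altdef poly_altdef umbral_sum umbral_smult coeff_map_poly degree_map_poly
      flip: smult_conv_map_poly)

lemma umbral_linear_power:
  "umbral ([:a, 1:] ^ m) = (\<Sum>i\<le>m. real (m choose i) * euler_number i * a ^ (m - i))"
proof -
  have "[:a, 1:] ^ m = (monom 1 1 + [:a:]) ^ m"
    by (simp add: monom_Suc one_pCons)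
  also have "\<dots> = (\<Sum>i\<le>m. monom (real (m choose i) * a ^ (m - i)) i)"
    unfolding binomial_ring
    by (intro sum.cong refl)
      (simp add: monom_power poly_const_pow of_nat_poly smult_monom mult.commute)
  finally show ?thesis
    by (simp add: umbral_sum mult_ac)
qed

text \<open>
  For \<open>p = x\<^sup>m\<close> this is the recurrence of the Euler numbers; the general case follows by linearity.
\<close>

lemma umbral_shift:
  "umbral (pcompose p [:1, 1:]) + umbral (pcompose p [:-1, 1:]) = 2 * poly p 0"
proof -
  have "umbral ([:1, 1:] ^ m) + umbral ([:-1, 1:] ^ m) = (if m = 0 then 2 else 0)" for m
    unfolding umbral_linear_power euler_number_recurrence[symmetric]
    by (simp add: sum.distrib[symmetric] algebra_simps)
  then have "umbral (pcompose p [:1, 1:]) + umbral (pcompose p [:-1, 1:])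
      = (\<Sum>m\<le>degree p. coeff p m * (if m = 0 then 2 else 0))"
    by (simp only: umbral_pcompose degree_pCons_eq sum.distrib[symmetric] distrib_left[symmetric])
  then show ?thesis
    by (simp add: poly_0_coeff_0 if_distrib sum.delta cong: if_cong)
qed

lemma umbral_reflect: "umbral (pcompose p [:0, -1:]) = umbral p"
proof -
  have "umbral ([:0, -1:] ^ m) = euler_number m" for m
  proof -
    have "[:0, -1:] ^ m = monom ((-1) ^ m :: real) m"
      using monom_power[of "-1 :: real" 1 m] by (simp add: monom_Suc monom_0)
    then show ?thesis
      using euler_number_odd[of m] by (cases "even m") auto
  qed
  then show ?thesis
    by (simp only: umbral_pcompose) (simp only: umbral_def)
qed

text \<open>
  Each step replaces the remainder by \<open>L(p(x)) = 2 p(1) - L(p(x + 2))\<close>, the shift rule moved to the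
  current base point.
\<close>

lemma umbral_telescope:
  "umbral p = (\<Sum>k<m. 2 * (-1) ^ k * poly p (2 * real k + 1))
     + (-1) ^ m * umbral (pcompose p [:2 * real m, 1:])"
proof (induction m)
  case 0
  then show ?case by (simp add: pcompose_idR)
next
  case (Suc m)
  have "umbral (pcompose p [:2 * real (Suc m), 1:]) + umbral (pcompose p [:2 * real m, 1:])
      = 2 * poly p (2 * real m + 1)"
    using umbral_shift[of "pcompose p [:2 * real m + 1, 1:]"]
    by (simp add: pcompose_assoc[symmetric] poly_pcompose pcompose_pCons algebra_simps)
  then have "(-1) ^ m * umbral (pcompose p [:2 * real m, 1:])
      = 2 * (-1) ^ m * poly p (2 * real m + 1)
        + (-1) ^ Suc m * umbral (pcompose p [:2 * real (Suc m), 1:])"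
    by (simp add: algebra_simps flip: distrib_left)
  with Suc show ?case
    by simp
qed

text \<open>
  The symmetry about \<open>J\<close> makes the remainder of the telescoped sum equal to \<open>-L(p)\<close>, the sign
  coming from \<open>J\<close> being odd, so that the relation can be solved for \<open>L(p)\<close>.
\<close>

lemma umbral_symmetric:
  assumes "odd J" and sym: "\<And>x. poly p (2 * real J - x) = poly p x"
  shows "umbral p = (\<Sum>k<J. (-1) ^ k * poly p (2 * real k + 1))"
proof -
  have "pcompose p [:2 * real J, 1:] = pcompose p [:0, -1:]"
    using sym by (intro poly_ext) (simp add: poly_pcompose, metis diff_minus_eq_add)
  then have "umbral (pcompose p [:2 * real J, 1:]) = umbral p"
    by (simp add: umbral_reflect)
  with umbral_telescope[of p J] \<open>odd J\<close> show ?thesis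
    by (simp add: sum_distrib_left[symmetric] mult.assoc)
qed

section \<open>Folding a symmetric alternating sum\<close>

text \<open>
  The odd numbers \<open>1, 3, \<dots>, 2J - 1\<close> lie symmetrically about \<open>J\<close>, which is itself one of them because
  it is odd. Reflection preserves the signs, so the terms below \<open>J\<close> repeat those above it.
\<close>

lemma alternating_sum_fold:
  fixes g :: "real \<Rightarrow> real"
  assumes J: "J = 2 * h + 1" and sym: "\<And>x. g (2 * real J - x) = g x"
  shows "(\<Sum>k<J. (-1) ^ k * g (2 * real k + 1))
    = (-1) ^ h * (g (real J) + 2 * (\<Sum>k=1..h. (-1) ^ k * g (real J + 2 * real k)))"
proof -
  let ?t = "\<lambda>k. (-1) ^ k * g (2 * real k + 1)"
  let ?s = "\<Sum>k=1..h. (-1) ^ k * g (real J + 2 * real k)"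
  have up: "(\<Sum>k=h+1..h+h. ?t k) = (-1) ^ h * ?s"
    unfolding sum_distrib_left
    by (rule sum.reindex_bij_witness[where i = "\<lambda>k. h + k" and j = "\<lambda>k. k - h"])
      (auto simp: J algebra_simps simp flip: power_add)
  have "(\<Sum>k<h. ?t k) = (\<Sum>k=h+1..h+h. ?t k)"
  proof (rule sum.reindex_bij_witness[where i = "\<lambda>k. 2 * h - k" and j = "\<lambda>k. 2 * h - k"])
    fix k assume "k \<in> {..<h}"
    then have "k < h" by simp
    then have "even (2 * h - k) = even k" "2 * real (2 * h - k) + 1 = 2 * real J - (2 * real k + 1)"
      by (simp_all add: J)
    then show "?t (2 * h - k) = ?t k"
      by (simp only: sym minus_one_power_iff)
  qed auto
  moreover have "{..<J} = {..<h} \<union> {h} \<union> {h+1..h+h}"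
    using J by auto
  then have "sum ?t {..<J} = sum ?t {..<h} + ?t h + sum ?t {h+1..h+h}"
    by (simp add: sum.union_disjoint disjoint_iff)
  ultimately show ?thesis
    using up by (simp add: J algebra_simps)
qed

section \<open>The Euler number identity\<close>

text \<open>
  On the range of summation both Gamma values are factorials, so that the weights become binomial
  coefficients up to the factor \<open>1 / (n + 1)!\<close>.
\<close>

lemma sum_Gamma_eq:
  "(\<Sum>j=0..n+1. c j / (Gamma (real n - real j + 2) * Gamma (real j + 1)))
    = (\<Sum>j\<le>n+1. real (Suc n choose j) * c j) / fact (Suc n)"
proof -
  have "c j / (Gamma (real n - real j + 2) * Gamma (real j + 1))
      = real (Suc n choose j) * c j / fact (Suc n)" if "j \<le> n + 1" for j
  proof -
    have "real n - real j + 2 = 1 + real (Suc n - j)"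
      using that by simp
    then have "Gamma (real n - real j + 2) = fact (Suc n - j)" "Gamma (real j + 1) = fact j"
      by (metis Gamma_fact) (metis Gamma_fact add.commute)
    then show ?thesis
      using that by (simp add: binomial_fact del: fact_Suc)
  qed
  then show ?thesis
    by (simp add: sum_divide_distrib atLeast0AtMost del: fact_Suc binomial_Suc_Suc sum.atMost_Suc)
qed

lemma power_mult_one_add:
  fixes c x :: "'a :: comm_ring_1"
  shows "(x * (1 + c * x)) ^ N = (\<Sum>j\<le>N. of_nat (N choose j) * (c ^ j * x ^ (N + j)))"
proof -
  have "(x * (1 + c * x)) ^ N = x ^ N * (c * x + 1) ^ N"
    by (simp add: power_mult_distrib add.commute)
  then show ?thesis
    by (simp add: binomial_ring sum_distrib_left power_mult_distrib power_add mult_ac)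
qed

theorem mainTheorem4:
  fixes J n :: nat
  assumes "J > 0" and "odd J"
  shows "(\<Sum>j=0..n+1. (-1 / (2 * real J)) ^ j * euler_number (1 + n + j)
            / (Gamma (real n - real j + 2) * Gamma (real j + 1)))
       = 2 * (-1) ^ ((J + 1) div 2) / ((2 * real J) ^ (n + 1) * Gamma (real n + 2))
            * (\<Sum>k=1..(J - 1) div 2. (-1) ^ k * ((real J)\<^sup>2 - 4 * (real k)\<^sup>2) ^ (n + 1))
         - 2 ^ (n + 2)
            * (\<Sum>j=0..n+1. (-1 / real J) ^ j * (1 / (Gamma (real n - real j + 2) * Gamma (real j + 1)))
                * (\<Sum>k=1..J. (-1) ^ k * (real k - 1 / 2) ^ (1 + n + j)))
         + (-1) ^ ((J + 1) div 2) * (real J / 2) ^ (n + 1) / Gamma (real n + 2)"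
proof -
  define N where "N = n + 1"
  define c where "c = -1 / (2 * real J)"
  define p where "p = (monom 1 1 * (1 + [:c:] * monom 1 1)) ^ N"
  define L where "L = umbral p"
  obtain h where h: "J = 2 * h + 1"
    using \<open>odd J\<close> oddE by blast
  have p_eq: "poly p x = (x * (1 + c * x)) ^ N" for x
    by (simp add: p_def poly_monom)
  have p_centre: "poly p x = (((real J)\<^sup>2 - (x - real J)\<^sup>2) / (2 * real J)) ^ N" for x
  proof -
    have "x * (1 + c * x) = ((real J)\<^sup>2 - (x - real J)\<^sup>2) / (2 * real J)"
      using \<open>J > 0\<close> by (simp add: c_def field_simps power2_eq_square)
    then show ?thesis by (simp add: p_eq)
  qed
  have p_sym: "poly p (2 * real J - x) = poly p x" for x
    by (simp add: p_centre power2_commute)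
  have Gamma_N: "Gamma (real n + 2) = fact N"
    using Gamma_fact[of N, where ?'a = real] by (simp add: N_def algebra_simps)

  have L_odd: "L = (\<Sum>k<J. (-1) ^ k * poly p (2 * real k + 1))"
    unfolding L_def using \<open>odd J\<close> p_sym by (rule umbral_symmetric)

  have lhs: "(\<Sum>j=0..n+1. c ^ j * euler_number (1 + n + j)
            / (Gamma (real n - real j + 2) * Gamma (real j + 1))) = L / fact N"
  proof -
    have "p = (\<Sum>j\<le>N. monom (real (N choose j) * c ^ j) (N + j))"
      unfolding p_def power_mult_one_add
      by (simp add: of_nat_poly poly_const_pow monom_power smult_monom)
    then have "L = (\<Sum>j\<le>N. real (N choose j) * (c ^ j * euler_number (1 + n + j)))"
      by (simp only: L_def umbral_sum umbral_monom) (simp add: N_def mult.assoc)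
    then show ?thesis
      unfolding sum_Gamma_eq N_def by (simp del: fact_Suc binomial_Suc_Suc)
  qed

  have second: "2 ^ (n + 2)
            * (\<Sum>j=0..n+1. (-1 / real J) ^ j * (1 / (Gamma (real n - real j + 2) * Gamma (real j + 1)))
                * (\<Sum>k=1..J. (-1) ^ k * (real k - 1 / 2) ^ (1 + n + j))) = - 2 * L / fact N"
  proof -
    \<comment> \<open>With \<open>x = k - 1/2\<close> the summand is \<open>(x (1 - x / J))\<^sup>N\<close>, which is \<open>p(2x) / 2\<^sup>N\<close>.\<close>
    have "(\<Sum>j\<le>N. real (N choose j) * ((2 * c) ^ j * (\<Sum>k=1..J. (-1) ^ k * (real k - 1 / 2) ^ (N + j))))
        = (\<Sum>k=1..J. (-1) ^ k * (\<Sum>j\<le>N. real (N choose j) * ((2 * c) ^ j * (real k - 1 / 2) ^ (N + j))))"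
      unfolding sum_distrib_left by (subst sum.swap) (simp add: mult_ac)
    also have "\<dots> = (\<Sum>k=1..J. (-1) ^ k * ((real k - 1 / 2) * (1 + 2 * c * (real k - 1 / 2))) ^ N)"
      by (simp add: power_mult_one_add)
    also have "\<dots> = (\<Sum>k<J. (-1) ^ Suc k * ((real k + 1 / 2) * (1 + 2 * c * (real k + 1 / 2))) ^ N)"
      by (rule sum.reindex_bij_witness[where i = Suc and j = "\<lambda>k. k - 1"])
         (auto simp: of_nat_diff)
    also have "\<dots> = (\<Sum>k<J. - (1 / 2 ^ N) * ((-1) ^ k * poly p (2 * real k + 1)))"
    proof (intro sum.cong refl)
      fix k
      have "(real k + 1 / 2) * (1 + 2 * c * (real k + 1 / 2))
          = (2 * real k + 1) * (1 + c * (2 * real k + 1)) / 2"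
        by (simp add: algebra_simps)
      then have "((real k + 1 / 2) * (1 + 2 * c * (real k + 1 / 2))) ^ N
          = poly p (2 * real k + 1) / 2 ^ N"
        by (simp only: p_eq power_divide)
      then show "(-1) ^ Suc k * ((real k + 1 / 2) * (1 + 2 * c * (real k + 1 / 2))) ^ N
          = - (1 / 2 ^ N) * ((-1) ^ k * poly p (2 * real k + 1))"
        by simp
    qed
    also have "\<dots> = - L / 2 ^ N"
      by (simp only: sum_distrib_left[symmetric] L_odd[symmetric]) simp
    finally have inner: "(\<Sum>j\<le>N. real (N choose j) * ((2 * c) ^ j * (\<Sum>k=1..J. (-1) ^ k * (real k - 1 / 2) ^ (N + j))))
        = - L / 2 ^ N" .
    have "(\<Sum>j=0..n+1. (-1 / real J) ^ j * (1 / (Gamma (real n - real j + 2) * Gamma (real j + 1)))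
                * (\<Sum>k=1..J. (-1) ^ k * (real k - 1 / 2) ^ (1 + n + j)))
        = (\<Sum>j=0..n+1. ((2 * c) ^ j * (\<Sum>k=1..J. (-1) ^ k * (real k - 1 / 2) ^ (N + j)))
            / (Gamma (real n - real j + 2) * Gamma (real j + 1)))"
      by (simp add: c_def N_def)
    also have "\<dots> = - L / 2 ^ N / fact N"
      using inner unfolding sum_Gamma_eq N_def by (simp del: fact_Suc binomial_Suc_Suc)
    finally show ?thesis
      by (simp add: N_def del: fact_Suc)
  qed

  have first_third: "2 * (-1) ^ ((J + 1) div 2) / ((2 * real J) ^ (n + 1) * Gamma (real n + 2))
            * (\<Sum>k=1..(J - 1) div 2. (-1) ^ k * ((real J)\<^sup>2 - 4 * (real k)\<^sup>2) ^ (n + 1))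
         + (-1) ^ ((J + 1) div 2) * (real J / 2) ^ (n + 1) / Gamma (real n + 2) = - L / fact N"
  proof -
    have "poly p (real J) = (real J / 2) ^ N"
      using \<open>J > 0\<close> by (simp add: p_centre power2_eq_square)
    moreover have "poly p (real J + 2 * real k) = ((real J)\<^sup>2 - 4 * (real k)\<^sup>2) ^ N / (2 * real J) ^ N" for k
      by (simp add: p_centre power_divide power_mult_distrib)
    ultimately have "L = (-1) ^ h * ((real J / 2) ^ N
        + 2 * (\<Sum>k=1..h. (-1) ^ k * ((real J)\<^sup>2 - 4 * (real k)\<^sup>2) ^ N) / (2 * real J) ^ N)"
      using alternating_sum_fold[of J h "poly p", OF h p_sym]
      by (simp add: L_odd flip: sum_divide_distrib)
    moreover have "(J + 1) div 2 = Suc h" "(J - 1) div 2 = h"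
      using h by auto
    ultimately show ?thesis
      unfolding Gamma_N N_def[symmetric] by (simp add: field_simps del: fact_Suc)
  qed

  show ?thesis
    using lhs second first_third unfolding c_def by simp
qed

end
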